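(* Let $m$ and $p$ be positive integers, and write $m=k2^z$ with $k$ odd and $z\in\mathbb{N}$. Then the state complexity of $m\mathcal{T}=\{mt\colon t\in\mathcal{T}\}$ with respect to the base $2^p$ is equal to \[ 2k+\left\lceil \frac zp\right\rceil . \]
   Context: $\mathbb{N}=\{0,1,2,\ldots\}$. The Thue-Morse set $\mathcal{T}$ is the set of all $n\in\mathbb{N}$ whose base-2 expansion contains an even number of occurrences of the digit $1$ (so $0\in\mathcal{T}$). For an integer $b\ge 2$, let $A_b=\{0,1,\ldots,b-1\}$ and, for a word $w=c_{\ell-1}\cdots c_0$ over $A_b$, let $\mathrm{val}_b(w)=\sum_{j=0}^{\ell-1}c_jb^j$ (most significant digit first; $\mathrm{val}_b(\varepsilon)=0$). For $X\subseteq\mathbb{N}$, $\mathrm{val}_b^{-1}(X)=\{w\in A_b^*\colon \mathrm{val}_b(w)\in X\}$ (leading zeroes allowed). The state complexity of a regular language $L$ over an alphabet $A$ is the number of its distinct left quotients $w^{-1}L=\{u\in A^*\colon wu\in L\}$, $w\in A^*$; equivalently, the number of states of its minimal (complete) deterministic automaton. The state complexity of $X\subseteq\mathbb{N}$ with respect to the base $b$ is the state complexity of the language $\mathrm{val}_b^{-1}(X)$ over $A_b$. *)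

theory Defs
  imports Complex_Main
begin

definition thue_morse :: "nat set" where
  "thue_morse = {n. even (card {i. bit n i})}"

abbreviation digits :: "nat \<Rightarrow> nat set" where
  "digits b \<equiv> {..<b}"

text \<open>Words are lists with the most significant digit first, so the coefficient of
  \<open>b ^ j\<close> is the \<open>j\<close>-th entry of the reversed list.\<close>

definition val :: "nat \<Rightarrow> nat list \<Rightarrow> nat" where
  "val b w = (\<Sum>j<length w. rev w ! j * b ^ j)"

definition val_lang :: "nat \<Rightarrow> nat set \<Rightarrow> nat list set" where
  "val_lang b X = {w \<in> lists (digits b). val b w \<in> X}"

definition left_quotient :: "'a set \<Rightarrow> 'a list \<Rightarrow> 'a list set \<Rightarrow> 'a list set" where
  "left_quotient A w L = {u \<in> lists A. w @ u \<in> L}"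

text \<open>The state complexity is only meaningful for a regular language. Since \<open>card\<close> of an infinite
  set is \<open>0\<close> and there is always at least one quotient, the value \<open>0\<close> occurs exactly when the
  set of quotients is infinite, i.e. when the language is not regular (over a finite alphabet).
  An equation with a positive right-hand side therefore includes regularity.\<close>

definition state_complexity_lang :: "'a set \<Rightarrow> 'a list set \<Rightarrow> nat" where
  "state_complexity_lang A L = card ((\<lambda>w. left_quotient A w L) ` lists A)"

definition state_complexity :: "nat \<Rightarrow> nat set \<Rightarrow> nat" where
  "state_complexity b X = state_complexity_lang (digits b) (val_lang b X)"

end

theory Submission
  imports Defs "HOL-Number_Theory.Cong"
begin

text \<open>The quotient of \<open>val_lang b X\<close> by a word \<open>w\<close> only depends on \<open>n = val b w\<close>. Put
  \<open>r = n mod k\<close> and \<open>J = n div k\<close>. A suffix of length \<open>l\<close> with \<open>p * l \<ge> z\<close> sees of \<open>n\<close> only \<open>r\<close>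
  and whether \<open>J\<close> is in the Thue-Morse set, and long suffixes do separate these \<open>2 * k\<close> pairs. The
  only shorter suffixes that can be accepted consist of zeroes; \<open>0\<^sup>l\<close> is accepted if and only if
  \<open>r = 0\<close>, \<open>J\<close> is in the Thue-Morse set and \<open>2 ^ (z - p * l)\<close> divides \<open>J\<close>. The least such \<open>l\<close>
  thus splits one of the \<open>2 * k\<close> classes into \<open>\<lceil>z / p\<rceil> + 1\<close> classes.\<close>

section \<open>Quotients of numeration languages\<close>

lemma val_append: "val b (w @ u) = val b w * b ^ length u + val b u"
proof -
  have val: "val b w = horner_sum id b (rev w)" for w
    by (simp add: val_def horner_sum_eq_sum atLeast0LessThan)
  show ?thesis
    by (simp add: val horner_sum_append algebra_simps)
qed

lemma val_Nil [simp]: "val b [] = 0"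
  by (simp add: val_def)

lemma val_singleton [simp]: "val b [a] = a"
  by (simp add: val_def)

lemma val_less:
  assumes "w \<in> lists (digits b)"
  shows "val b w < b ^ length w"
  using assms
proof (induction w rule: rev_induct)
  case (snoc a w)
  then have "a < b" and "val b w + 1 \<le> b ^ length w"
    by auto
  then have "val b w * b + a < (val b w + 1) * b"
    by simp
  also have "\<dots> \<le> b ^ length w * b"
    using \<open>val b w + 1 \<le> b ^ length w\<close> by (rule mult_le_mono1)
  finally show ?case
    by (simp add: val_append mult.commute)
qed simp

lemma ex_word_of_val:
  assumes "v < b ^ l"
  shows "\<exists>w \<in> lists (digits b). length w = l \<and> val b w = v"
  using assms
proof (induction l arbitrary: v)
  case (Suc l)
  then have "b > 0"
    by (cases b) auto
  have "v div b < b ^ l"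
    using Suc.prems by (simp add: less_mult_imp_div_less mult.commute)
  then obtain w where "w \<in> lists (digits b)" "length w = l" "val b w = v div b"
    using Suc.IH by blast
  with \<open>b > 0\<close> show ?case
    by (intro bexI[of _ "w @ [v mod b]"]) (auto simp: val_append)
qed auto

lemma surj_val:
  assumes "b \<ge> 2"
  shows "val b ` lists (digits b) = UNIV"
proof -
  have "n \<in> val b ` lists (digits b)" for n
  proof -
    have "n < 2 ^ n"
      by simp
    also have "\<dots> \<le> b ^ n"
      using assms by (rule power_mono) simp
    finally show ?thesis
      by (metis ex_word_of_val imageI)
  qed
  then show ?thesis
    by blast
qed

text \<open>Reduces the count of quotients to arithmetic: it suffices to find a complete invariant
  \<open>f\<close> of the values of prefixes. Every natural number is such a value, and every
  \<open>v < b ^ l\<close> is the value of a suffix of length exactly \<open>l\<close>.\<close>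

lemma state_complexity_eq_card_range:
  assumes "b \<ge> 2"
    and "\<And>n n'. f n = f n' \<longleftrightarrow>
      (\<forall>l. \<forall>v < b ^ l. n * b ^ l + v \<in> X \<longleftrightarrow> n' * b ^ l + v \<in> X)"
  shows "state_complexity b X = card (range f)"
proof -
  define Q where "Q n = {u \<in> lists (digits b). n * b ^ length u + val b u \<in> X}" for n
  have Q_eq: "Q n = Q n' \<longleftrightarrow> f n = f n'" for n n'
  proof -
    have "Q n = Q n' \<longleftrightarrow>
      (\<forall>l. \<forall>v < b ^ l. n * b ^ l + v \<in> X \<longleftrightarrow> n' * b ^ l + v \<in> X)"
    proof
      assume eq: "Q n = Q n'"
      show "\<forall>l. \<forall>v < b ^ l. n * b ^ l + v \<in> X \<longleftrightarrow> n' * b ^ l + v \<in> X"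
      proof (intro allI impI)
        fix l v assume "v < b ^ l"
        then obtain w where "w \<in> lists (digits b)" "length w = l" "val b w = v"
          using ex_word_of_val by blast
        moreover from eq have "w \<in> Q n \<longleftrightarrow> w \<in> Q n'"
          by simp
        ultimately show "n * b ^ l + v \<in> X \<longleftrightarrow> n' * b ^ l + v \<in> X"
          by (simp add: Q_def)
      qed
    next
      assume "\<forall>l. \<forall>v < b ^ l. n * b ^ l + v \<in> X \<longleftrightarrow> n' * b ^ l + v \<in> X"
      with val_less show "Q n = Q n'"
        unfolding Q_def by blast
    qed
    with assms(2) show ?thesis
      by simp
  qed
  have "left_quotient (digits b) w (val_lang b X) = Q (val b w)" if "w \<in> lists (digits b)" for w
    using that by (auto simp: left_quotient_def val_lang_def Q_def val_append)
  then have "(\<lambda>w. left_quotient (digits b) w (val_lang b X)) ` lists (digits b) =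
      Q ` val b ` lists (digits b)"
    by (simp add: image_image)
  also have "\<dots> = range Q"
    by (simp add: surj_val assms(1))
  finally have "state_complexity b X = card (range Q)"
    by (simp add: state_complexity_def state_complexity_lang_def)
  also have "\<dots> = card (range f)"
  proof (rule bij_betw_same_card)
    \<comment> \<open>\<open>inv Q\<close> picks some value with the given quotient;
      \<open>f\<close> does not depend on the choice.\<close>
    have "f (inv Q (Q n)) = f n" for n
      using Q_eq by (metis f_inv_into_f rangeI)
    with Q_eq show "bij_betw (\<lambda>q. f (inv Q q)) (range Q) (range f)"
      by (auto simp: bij_betw_def inj_on_def image_image)
  qed
  finally show ?thesis .
qed

section \<open>The Thue-Morse set\<close>

lemma thue_morse_zero [simp]: "0 \<in> thue_morse"
  by (simp add: thue_morse_def bot_fun_def)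

lemma thue_morse_double [simp]: "2 * n \<in> thue_morse \<longleftrightarrow> n \<in> thue_morse"
proof -
  have "{i. bit (2 * n) i} = Suc ` {i. bit n i}"
    by (auto simp: bit_double_iff image_iff gr0_conv_Suc Suc_le_eq)
  then show ?thesis
    by (simp add: thue_morse_def card_image)
qed

lemma thue_morse_Suc_double [simp]: "Suc (2 * n) \<in> thue_morse \<longleftrightarrow> n \<notin> thue_morse"
proof -
  have "bit (Suc (2 * n)) i \<longleftrightarrow> i \<in> insert 0 (Suc ` {i. bit n i})" for i
    by (cases i) (auto simp: bit_Suc bit_0)
  then have "{i. bit (Suc (2 * n)) i} = insert 0 (Suc ` {i. bit n i})"
    by blast
  \<comment> \<open>Without finiteness, inserting \<open>0\<close> need not change the parity of
    \<open>card\<close>.\<close>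
  moreover have "finite {i. bit n i}"
  proof (rule finite_subset)
    show "{i. bit n i} \<subseteq> {..n}"
    proof
      fix i assume "i \<in> {i. bit n i}"
      then have "2 ^ i \<le> n"
        by (metis bit_nat_def div_less even_zero linorder_not_le mem_Collect_eq)
      with less_exp[of i] show "i \<in> {..n}"
        by (simp del: less_exp)
    qed
  qed simp
  ultimately show ?thesis
    by (simp add: thue_morse_def card_image)
qed

text \<open>The binary digits of \<open>a * 2 ^ L\<close> and of \<open>v\<close> occupy disjoint
  positions, so the numbers of ones add up. The induction strips the lowest bit of
  \<open>v\<close>.\<close>

lemma thue_morse_concat:
  assumes "v < 2 ^ L"
  shows "a * 2 ^ L + v \<in> thue_morse \<longleftrightarrow> (a \<in> thue_morse \<longleftrightarrow> v \<in> thue_morse)"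
  using assms
proof (induction L arbitrary: v)
  case (Suc L)
  obtain u where u: "v = 2 * u \<or> v = Suc (2 * u)"
    by (metis even_two_times_div_two odd_two_times_div_two_succ Suc_eq_plus1)
  with Suc.prems have "a * 2 ^ L + u \<in> thue_morse \<longleftrightarrow> (a \<in> thue_morse \<longleftrightarrow> u \<in> thue_morse)"
    by (intro Suc.IH) auto
  moreover have "a * 2 ^ Suc L + 2 * u = 2 * (a * 2 ^ L + u)"
    "a * 2 ^ Suc L + Suc (2 * u) = Suc (2 * (a * 2 ^ L + u))"
    by simp_all
  ultimately show ?case
    using u by (metis thue_morse_double thue_morse_Suc_double)
qed auto

lemma thue_morse_mult_power2: "2 ^ L * a \<in> thue_morse \<longleftrightarrow> a \<in> thue_morse"
  using thue_morse_concat[of 0 L a] by (simp add: mult.commute)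

lemma one_notin_thue_morse [simp]: "Suc 0 \<notin> thue_morse"
  using thue_morse_Suc_double[of 0] by simp

lemma three_in_thue_morse: "3 \<in> thue_morse"
proof -
  have "3 = Suc (2 * Suc 0)"
    by simp
  then show ?thesis
    by (metis thue_morse_Suc_double one_notin_thue_morse)
qed

section \<open>Accepted suffixes\<close>

text \<open>As \<open>z \<le> N\<close>, the part of \<open>n * 2 ^ N\<close> coming from
  \<open>n div k\<close> is a multiple of \<open>k * 2 ^ z\<close> and can be split off. Because
  \<open>n mod k < k\<close>, the cofactor \<open>t\<close> of the rest is below
  \<open>2 ^ (N - z)\<close>, so its digits do not overlap those of the shifted
  \<open>n div k\<close>, and the parities combine.\<close>

lemma mem_multiples_thue_morse_long:
  fixes k :: nat
  assumes "k > 0" and "z \<le> N" and v: "v < 2 ^ N"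
  shows "n * 2 ^ N + v \<in> {k * 2 ^ z * t | t. t \<in> thue_morse} \<longleftrightarrow>
    (\<exists>t. k * 2 ^ z * t = n mod k * 2 ^ N + v \<and> (t \<in> thue_morse \<longleftrightarrow> n div k \<in> thue_morse))"
    (is "_ = (\<exists>t. ?P t)")
proof -
  define J r where "J = n div k" and "r = n mod k"
  have N: "2 ^ N = 2 ^ z * (2::nat) ^ (N - z)"
    using assms(2) by (simp flip: power_add)
  have "n = k * J + r"
    by (simp add: J_def r_def)
  then have split: "n * 2 ^ N + v = k * 2 ^ z * (J * 2 ^ (N - z)) + (r * 2 ^ N + v)"
    by (simp add: N algebra_simps)
  have concat: "J * 2 ^ (N - z) + t \<in> thue_morse \<longleftrightarrow> (J \<in> thue_morse \<longleftrightarrow> t \<in> thue_morse)"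
    if t: "k * 2 ^ z * t = r * 2 ^ N + v" for t
  proof (rule thue_morse_concat)
    have "r + 1 \<le> k"
      using assms(1) by (simp add: r_def Suc_le_eq)
    have "k * 2 ^ z * t < (r + 1) * 2 ^ N"
      using t v by simp
    also have "\<dots> \<le> k * 2 ^ N"
      using \<open>r + 1 \<le> k\<close> by (rule mult_le_mono1)
    also have "\<dots> = k * 2 ^ z * 2 ^ (N - z)"
      by (simp add: N)
    finally show "t < 2 ^ (N - z)"
      by simp
  qed
  show ?thesis
  proof
    assume "n * 2 ^ N + v \<in> {k * 2 ^ z * t | t. t \<in> thue_morse}"
    then obtain s where s: "n * 2 ^ N + v = k * 2 ^ z * s" "s \<in> thue_morse"
      by blast
    then have "k * 2 ^ z * (J * 2 ^ (N - z)) \<le> k * 2 ^ z * s"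
      using split by linarith
    then have "J * 2 ^ (N - z) \<le> s"
      using assms(1) by simp
    then obtain t where t: "s = J * 2 ^ (N - z) + t"
      using le_Suc_ex by blast
    with s(1) split have "k * 2 ^ z * t = r * 2 ^ N + v"
      by (simp add: distrib_left)
    with concat s(2) t show "\<exists>t. ?P t"
      by (auto simp: J_def r_def)
  next
    assume "\<exists>t. ?P t"
    then obtain t where t: "k * 2 ^ z * t = r * 2 ^ N + v" "t \<in> thue_morse \<longleftrightarrow> J \<in> thue_morse"
      by (auto simp: J_def r_def)
    then have "n * 2 ^ N + v = k * 2 ^ z * (J * 2 ^ (N - z) + t)"
      using split by (simp add: distrib_left)
    with concat t show "n * 2 ^ N + v \<in> {k * 2 ^ z * t | t. t \<in> thue_morse}"
      by blast
  qed
qed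

text \<open>Here \<open>2 ^ N\<close> divides \<open>2 ^ z\<close>, hence every member of the set;
  this forces \<open>v = 0\<close>, and then \<open>2 ^ N\<close> cancels.\<close>

lemma mem_multiples_thue_morse_short:
  fixes k :: nat
  assumes "k > 0" and "N \<le> z" and v: "v < 2 ^ N"
  shows "n * 2 ^ N + v \<in> {k * 2 ^ z * t | t. t \<in> thue_morse} \<longleftrightarrow>
    v = 0 \<and> n mod k = 0 \<and> n div k \<in> thue_morse \<and> 2 ^ (z - N) dvd n div k"
proof
  have z: "2 ^ z = 2 ^ N * (2::nat) ^ (z - N)"
    using assms(2) by (simp flip: power_add)
  {
    assume "n * 2 ^ N + v \<in> {k * 2 ^ z * t | t. t \<in> thue_morse}"
    then obtain t where t: "n * 2 ^ N + v = k * 2 ^ z * t" "t \<in> thue_morse"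
      by auto
    have "2 ^ N dvd n * 2 ^ N + v"
      unfolding t(1) z by simp
    then have "2 ^ N dvd v"
      by (simp add: dvd_add_right_iff)
    with v have "v = 0"
      by (meson dvd_imp_le not_le neq0_conv)
    with t(1) z have "2 ^ N * n = 2 ^ N * (k * (2 ^ (z - N) * t))"
      by (simp add: algebra_simps)
    then have "n = k * (2 ^ (z - N) * t)"
      by simp
    with \<open>v = 0\<close> t(2) assms(1)
    show "v = 0 \<and> n mod k = 0 \<and> n div k \<in> thue_morse \<and> 2 ^ (z - N) dvd n div k"
      by (simp add: thue_morse_mult_power2)
  }
  {
    assume *: "v = 0 \<and> n mod k = 0 \<and> n div k \<in> thue_morse \<and> 2 ^ (z - N) dvd n div k"
    then obtain t where t: "n div k = 2 ^ (z - N) * t"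
      by blast
    with * have "t \<in> thue_morse"
      by (simp add: thue_morse_mult_power2)
    moreover have "n = k * (2 ^ (z - N) * t)"
      using * t by (metis dvd_mult_div_cancel mod_eq_0_iff_dvd)
    then have "n * 2 ^ N + v = k * 2 ^ z * t"
      using * by (simp add: z)
    ultimately show "n * 2 ^ N + v \<in> {k * 2 ^ z * t | t. t \<in> thue_morse}"
      by blast
  }
qed

section \<open>Classes of quotients\<close>

text \<open>Truncated subtraction makes the divisibility trivially true as soon as \<open>z \<le> p * l\<close>.\<close>

definition zero_depth :: "nat \<Rightarrow> nat \<Rightarrow> nat \<Rightarrow> nat" where
  "zero_depth p z J = (LEAST l. 2 ^ (z - p * l) dvd J)"

text \<open>The depth matters only where a suffix shorter than \<open>z\<close> bits can be
  accepted. Everywhere else the default \<open>0\<close> keeps each pair of the first two components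
  a single class.\<close>

definition quotient_class :: "nat \<Rightarrow> nat \<Rightarrow> nat \<Rightarrow> nat \<Rightarrow> nat \<times> bool \<times> nat" where
  "quotient_class p z k n = (n mod k, n div k \<in> thue_morse,
    if n mod k = 0 \<and> n div k \<in> thue_morse then zero_depth p z (n div k) else 0)"

text \<open>The condition under \<open>LEAST\<close> holds at \<open>l = z\<close>, where the
  exponent is \<open>0\<close> because \<open>p > 0\<close>, and it persists for larger
  \<open>l\<close> because the exponent decreases.\<close>

lemma zero_depth_le_iff:
  assumes "p > 0"
  shows "zero_depth p z J \<le> l \<longleftrightarrow> 2 ^ (z - p * l) dvd J"
proof
  have "2 ^ (z - p * z) dvd J"
    using assms by (cases p) auto
  then have "2 ^ (z - p * zero_depth p z J) dvd J"
    unfolding zero_depth_def by (rule LeastI)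
  moreover assume "zero_depth p z J \<le> l"
  then have "(2::nat) ^ (z - p * l) dvd 2 ^ (z - p * zero_depth p z J)"
    by (intro le_imp_power_dvd diff_le_mono2 mult_le_mono2)
  ultimately show "2 ^ (z - p * l) dvd J"
    by (rule dvd_trans[rotated])
next
  assume "2 ^ (z - p * l) dvd J"
  then show "zero_depth p z J \<le> l"
    unfolding zero_depth_def by (rule Least_le)
qed

text \<open>Identifies the ceiling as the least suffix length that covers \<open>z\<close> bits,
  which is the largest possible \<open>zero_depth\<close>.\<close>

lemma nat_ceiling_divide_le_iff:
  assumes "p > 0"
  shows "nat \<lceil>real z / real p\<rceil> \<le> l \<longleftrightarrow> z \<le> p * l"
proof -
  have "nat \<lceil>real z / real p\<rceil> \<le> l \<longleftrightarrow> real z / real p \<le> real l"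
    by (simp add: ceiling_le_iff nat_le_iff)
  also have "\<dots> \<longleftrightarrow> real z \<le> real (p * l)"
    using assms by (simp add: pos_divide_le_eq mult.commute)
  finally show ?thesis
    by (simp only: of_nat_le_iff)
qed

text \<open>The factor \<open>3\<close> makes the witness an element of the Thue-Morse set.\<close>

lemma zero_depth_three_power2:
  assumes "p > 0" and l: "l \<le> nat \<lceil>real z / real p\<rceil>"
  shows "zero_depth p z (2 ^ (z - p * l) * 3) = l"
proof (rule antisym)
  show "zero_depth p z (2 ^ (z - p * l) * 3) \<le> l"
    using assms(1) by (simp add: zero_depth_le_iff)
next
  let ?d = "zero_depth p z (2 ^ (z - p * l) * 3)"
  show "l \<le> ?d"
  proof (rule ccontr)
    assume "\<not> l \<le> ?d"
    then have "?d < l"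
      by simp
    \<comment> \<open>Below the ceiling the subtraction \<open>z - p * ?d\<close> is not truncated,
      so a smaller depth would demand a strictly higher power of two.\<close>
    with l have "\<not> nat \<lceil>real z / real p\<rceil> \<le> ?d"
      by linarith
    then have "p * ?d < z"
      by (simp only: nat_ceiling_divide_le_iff[OF assms(1)] not_le)
    have "2 ^ (z - p * ?d) dvd 2 ^ (z - p * l) * (3::nat)"
      using zero_depth_le_iff[OF assms(1)] by blast
    moreover have "coprime (2 ^ (z - p * ?d)) (3::nat)"
      by simp
    ultimately have "2 ^ (z - p * ?d) dvd (2::nat) ^ (z - p * l)"
      by (simp add: coprime_dvd_mult_left_iff)
    then have "z - p * ?d \<le> z - p * l"
      by (simp add: dvd_power_iff_le)
    moreover have "p * ?d < p * l"
      using \<open>?d < l\<close> assms(1) by simp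
    ultimately show False
      using \<open>p * ?d < z\<close> by linarith
  qed
qed

lemma card_range_quotient_class:
  assumes "p > 0" and "k > 0"
  shows "card (range (quotient_class p z k)) = 2 * k + nat \<lceil>real z / real p\<rceil>"
proof -
  let ?c = "nat \<lceil>real z / real p\<rceil>"
  \<comment> \<open>\<open>A\<close> holds the \<open>2 * k - 1\<close> pairs with default depth;
    \<open>B\<close> splits the remaining pair by the depths \<open>0\<close> to
    \<open>?c\<close>.\<close>
  define A where "A = (\<lambda>(r, e). (r, e, 0::nat)) ` ({..<k} \<times> (UNIV :: bool set) - {(0, True)})"
  define B where "B = (\<lambda>l. (0::nat, True, l)) ` {..?c}"
  have "zero_depth p z J \<le> ?c" for J
  proof -
    have "z \<le> p * ?c"
      using nat_ceiling_divide_le_iff[OF assms(1)] by blast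
    then show ?thesis
      using assms(1) by (simp add: zero_depth_le_iff)
  qed
  then have "quotient_class p z k n \<in> A \<union> B" for n
    using assms(2) by (cases "n mod k = 0 \<and> n div k \<in> thue_morse")
      (force simp: quotient_class_def A_def B_def)+
  moreover have "x \<in> range (quotient_class p z k)" if "x \<in> A \<union> B" for x
    using that
  proof
    assume "x \<in> A"
    then obtain r e where x: "x = (r, e, 0)" "r < k" "(r, e) \<noteq> (0, True)"
      by (auto simp: A_def)
    \<comment> \<open>The witness has \<open>n div k\<close> equal to \<open>0\<close>, which is in
      the Thue-Morse set, or to \<open>1\<close>, which is not.\<close>
    then have "x = quotient_class p z k (if e then r else k + r)"
      by (auto simp: quotient_class_def div_add_self1)
    then show ?thesis
      by blast
  next
    assume "x \<in> B"
    then obtain l where x: "x = (0, True, l)" "l \<le> ?c"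
      by (auto simp: B_def)
    then have "x = quotient_class p z k (k * (2 ^ (z - p * l) * 3))"
      using assms by (simp add: quotient_class_def thue_morse_mult_power2 three_in_thue_morse
          zero_depth_three_power2)
    then show ?thesis
      by blast
  qed
  ultimately have "range (quotient_class p z k) = A \<union> B"
    by blast
  moreover have "A \<inter> B = {}"
    by (auto simp: A_def B_def)
  moreover have "finite A" "finite B"
    by (simp_all add: A_def B_def)
  moreover have "card A = 2 * k - 1"
  proof -
    have "card A = card ({..<k} \<times> (UNIV :: bool set) - {(0, True)})"
      unfolding A_def by (intro card_image) (auto simp: inj_on_def)
    with assms(2) show ?thesis
      by (simp add: card_Diff_singleton card_cartesian_product)
  qed
  moreover have "card B = ?c + 1"
    by (simp add: B_def card_image inj_on_def)
  ultimately show ?thesis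
    using assms(2) by (simp add: card_Un_disjoint)
qed

text \<open>Some \<open>k * 2 ^ z * t\<close>, with \<open>t\<close> of the prescribed parity, lies
  in the block of length \<open>2 ^ N\<close> starting at \<open>(n mod k) * 2 ^ N\<close>;
  \<open>v\<close> is its offset there. Coprimality of \<open>k\<close> and \<open>2\<close> lets
  this offset determine both the residue and \<open>t\<close>.\<close>

lemma ex_long_suffix_separating:
  fixes k :: nat
  assumes "odd k" and N: "z + k + 2 \<le> N"
  shows "\<exists>v < 2 ^ N. \<forall>n'. n' * 2 ^ N + v \<in> {k * 2 ^ z * t | t. t \<in> thue_morse} \<longleftrightarrow>
    n' mod k = n mod k \<and> (n' div k \<in> thue_morse \<longleftrightarrow> n div k \<in> thue_morse)"
proof -
  have "k > 0"
    using assms(1) by (rule odd_pos)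
  define X :: nat where "X = 2 ^ (N - z)"
  have NX: "2 ^ N = 2 ^ z * X"
    using N by (simp add: X_def flip: power_add)
  have "4 * k < 4 * 2 ^ k"
    by simp
  also have "\<dots> = 2 ^ (k + 2)"
    by (simp add: power_add)
  also have "\<dots> \<le> X"
    unfolding X_def using N by (intro power_increasing) auto
  finally have X: "4 * k < X" .
  have "coprime X k"
    using assms(1) by (simp add: X_def)
  define r where "r = n mod k"
  \<comment> \<open>\<open>2 * k * a\<close> is the first multiple of \<open>2 * k\<close> strictly
    above \<open>r * X\<close>. So \<open>2 * k * a\<close> and \<open>2 * k * a + k\<close> exceed
    \<open>r * X\<close> by at most \<open>3 * k\<close>, which is less than
    \<open>X\<close>.\<close>
  define a where "a = r * X div (2 * k) + 1"
  \<comment> \<open>Exactly one of \<open>2 * a\<close> and \<open>2 * a + 1\<close> is in the Thue-Morse set.\<close>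
  obtain t where t: "t = 2 * a \<or> t = Suc (2 * a)" "t \<in> thue_morse \<longleftrightarrow> n div k \<in> thue_morse"
    using thue_morse_double thue_morse_Suc_double by blast
  have "r * X = 2 * k * (r * X div (2 * k)) + r * X mod (2 * k)"
    by simp
  moreover have "r * X mod (2 * k) < 2 * k"
    using \<open>k > 0\<close> by simp
  ultimately have a: "r * X < 2 * k * a" "2 * k * a \<le> r * X + 2 * k"
    unfolding a_def distrib_left by linarith+
  from t(1) have t_bounds: "2 * k * a \<le> k * t" "k * t \<le> 2 * k * a + k"
    by auto
  define v where "v = 2 ^ z * (k * t - r * X)"
  have "k * t - r * X < X"
    using a t_bounds X \<open>k > 0\<close> by linarith
  then have v: "v < 2 ^ N"
    by (simp add: v_def NX)
  have v_eq: "r * 2 ^ N + v = k * 2 ^ z * t"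
  proof -
    have "r * 2 ^ N + v = 2 ^ z * (r * X + (k * t - r * X))"
      by (simp add: v_def NX algebra_simps)
    also have "r * X + (k * t - r * X) = k * t"
      using a t_bounds by linarith
    finally show ?thesis
      by simp
  qed
  have iff: "k * 2 ^ z * t' = n' mod k * 2 ^ N + v \<longleftrightarrow> n' mod k = r \<and> t' = t" for n' t'
  proof
    assume "k * 2 ^ z * t' = n' mod k * 2 ^ N + v"
    with v_eq have "2 ^ z * (k * t' + r * X) = 2 ^ z * (n' mod k * X + k * t)"
      by (simp add: NX algebra_simps)
    then have eq: "k * t' + r * X = n' mod k * X + k * t"
      by simp
    \<comment> \<open>Modulo \<open>k\<close> the terms with \<open>t\<close> and \<open>t'\<close>
      vanish, and the invertible factor \<open>X\<close> can be cancelled.\<close>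
    then have "(k * t' + r * X) mod k = (n' mod k * X + k * t) mod k"
      by simp
    then have "[r * X = n' mod k * X] (mod k)"
      by (simp add: cong_def)
    then have "[r = n' mod k] (mod k)"
      using \<open>coprime X k\<close> by (simp add: cong_mult_rcancel_nat coprime_commute)
    then have "n' mod k = r"
      by (simp add: cong_def r_def)
    with eq \<open>k > 0\<close> show "n' mod k = r \<and> t' = t"
      by simp
  qed (simp add: v_eq)
  have "n' * 2 ^ N + v \<in> {k * 2 ^ z * t | t. t \<in> thue_morse} \<longleftrightarrow>
      n' mod k = r \<and> (n' div k \<in> thue_morse \<longleftrightarrow> n div k \<in> thue_morse)" for n'
    using mem_multiples_thue_morse_long[OF \<open>k > 0\<close> _ v, of z n'] N t(2) iff by auto
  with v show ?thesis
    unfolding r_def by blast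
qed

text \<open>Long suffixes see exactly the first two components. Zero suffixes of at most
  \<open>z\<close> bits test the divisibilities that define the depth.\<close>

lemma quotient_class_eq_iff:
  fixes k :: nat
  assumes "p > 0" and "odd k" and X: "X = {k * 2 ^ z * t | t. t \<in> thue_morse}"
  shows "quotient_class p z k n = quotient_class p z k n' \<longleftrightarrow>
    (\<forall>l. \<forall>v < 2 ^ (p * l). n * 2 ^ (p * l) + v \<in> X \<longleftrightarrow> n' * 2 ^ (p * l) + v \<in> X)"
    (is "_ \<longleftrightarrow> ?same")
proof
  have "k > 0"
    using assms(2) by (rule odd_pos)
  note long = mem_multiples_thue_morse_long[OF \<open>k > 0\<close>, where z = z, folded X]
  note short = mem_multiples_thue_morse_short[OF \<open>k > 0\<close>, where z = z, folded X]
  {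
    assume eq: "quotient_class p z k n = quotient_class p z k n'"
    show ?same
    proof (intro allI impI)
      fix l v :: nat assume v: "v < 2 ^ (p * l)"
      show "n * 2 ^ (p * l) + v \<in> X \<longleftrightarrow> n' * 2 ^ (p * l) + v \<in> X"
      proof (cases "z \<le> p * l")
        case True
        with eq v show ?thesis
          by (simp add: long quotient_class_def)
      next
        case False
        with eq v show ?thesis
          by (auto simp: short quotient_class_def simp flip: zero_depth_le_iff[OF assms(1)])
      qed
    qed
  }
  {
    assume same: ?same
    \<comment> \<open>The separating suffix must fill whole digits of base \<open>2 ^ p\<close>, so
      its bit length is taken as a multiple of \<open>p\<close>.\<close>
    define N where "N = p * (z + k + 2)"
    have "z + k + 2 \<le> N"
      using mult_le_mono1[of 1 p "z + k + 2"] assms(1) by (simp add: N_def)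
    from ex_long_suffix_separating[OF assms(2) this, of n]
    have sep: "n' mod k = n mod k" "n' div k \<in> thue_morse \<longleftrightarrow> n div k \<in> thue_morse"
      using same unfolding X N_def by blast+
    have "zero_depth p z (n div k) = zero_depth p z (n' div k)"
      if zero: "n mod k = 0" "n div k \<in> thue_morse"
    proof -
      have "2 ^ (z - p * l) dvd n div k \<longleftrightarrow> 2 ^ (z - p * l) dvd n' div k" for l
      proof (cases "p * l \<le> z")
        case True
        have "n * 2 ^ (p * l) + 0 \<in> X \<longleftrightarrow> n' * 2 ^ (p * l) + 0 \<in> X"
          using same by (metis zero_less_power zero_less_numeral)
        with short[OF True, of 0] zero sep show ?thesis
          by simp
      \<comment> \<open>For \<open>p * l > z\<close> the truncated exponent is \<open>0\<close>, and
        both divisibilities hold.\<close>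
      qed simp
      then show ?thesis
        by (simp add: zero_depth_def)
    qed
    with sep show "quotient_class p z k n = quotient_class p z k n'"
      by (auto simp: quotient_class_def)
  }
qed

theorem theorem3:
  fixes m p k z :: nat
  assumes "m > 0" and "p > 0" and "m = k * 2 ^ z" and "odd k"
  shows "int (state_complexity (2 ^ p) {m * t | t. t \<in> thue_morse}) =
    2 * int k + \<lceil>real z / real p\<rceil>"
proof -
  have "(2::nat) ^ 1 \<le> 2 ^ p"
    using assms(2) by (intro power_increasing) auto
  then have "state_complexity (2 ^ p) {m * t | t. t \<in> thue_morse} =
      card (range (quotient_class p z k))"
    using quotient_class_eq_iff[OF assms(2,4) refl, of z] unfolding assms(3)
    by (intro state_complexity_eq_card_range) (simp_all add: power_mult)
  also have "\<dots> = 2 * k + nat \<lceil>real z / real p\<rceil>"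
    using assms(2,4) by (intro card_range_quotient_class) (simp_all add: odd_pos)
  finally show ?thesis
    \<comment> \<open>The ceiling is nonnegative, so converting through \<open>nat\<close> loses
      nothing.\<close>
    using ceiling_mono[of 0 "real z / real p"] by simp
qed

end
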